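(* Assume (A0) and (A1). Then for every set $D$ with $G_{\le 0}\subseteq D\subseteq G$ and every $w\in\mathbb R^G$ there exists a unique $v^*\in\mathbb R^G$ solving the constrained QVI problem $$\max\{Lv+f,\ Mv-v\}=0\ \text{ on } D,\qquad\text{subject to } v=w \text{ on } D^c.$$ Further, $v^*_D$ is the unique solution $\tilde v\in\mathbb R^D$ of the restricted QVI $$\max\{\tilde L\tilde v+\tilde f,\ \tilde M\tilde v-\tilde v\}=0 .$$ Additionally, for any initial guess $\tilde v^0\in\mathbb R^D$, the sequence $(\tilde v^k)\subseteq\mathbb R^D$ defined by policy iteration applied to the restricted QVI converges exactly to $v^*_D$ in at most $|\tilde\Phi|$ iterations.
   Context: Grid and operators. $G$ is a symmetric grid $x_{-N}=-x_N<\dots<x_{-1}=-x_1<x_0=0<x_1<\dots<x_N$ of real numbers; $\mathbb R^G$ is the set of functions $G\to\mathbb R$ (vectors), linear operators on $\mathbb R^G$ are identified with matrices in $\mathbb R^{G\times G}$, and orders, max, argmax are pointwise (elementwise). $G_{<0}$, $G_{\le0}$ are the sets of negative, resp. nonpositive, grid points; complements are taken in $G$. $f\in\mathbb R^G$ and $L:\mathbb R^G\to\mathbb R^G$ is linear. For each $x\in G$, $Z(x)\subseteq\mathbb R$ is a finite nonempty set, with $Z(x)=\{0\}$ if $x\ge0$; $Z=\prod_{x\in G}Z(x)$. For each $\delta\in Z$, $B(\delta):\mathbb R^G\to\mathbb R^G$ is linear and $c(\delta)\in(0,+\infty)^G$; both are row-decoupled: row $x$ of $B(\delta)$ and of $c(\delta)$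 depends only on $\delta(x)$. Set $Mv=\max_{\delta\in Z}\{B(\delta)v-c(\delta)\}$. Strategies. $\Phi=\{\varphi=(I,\delta): I\subseteq G_{<0},\ \delta\in Z\}$. Matrix notions. For a real square matrix $A$: row $i$ is WDD (resp. SDD) if $|A_{ii}|\ge\sum_{j\ne i}|A_{ij}|$ (resp. $>$); $A$ is WDD (SDD) if all rows are; $A$ is an $L_0$-matrix if its off-diagonal entries are $\le0$ and its diagonal entries are $\ge0$. graph$A$ is the directed graph on the row indices with an edge $(i,j)$ iff $A_{ij}\neq0$; a walk is a nonempty finite sequence of consecutive edges. Assumptions. (A0) For each $\varphi=(I,\delta)\in\Phi$ and $x\in I$ there is a walk in graph$B(\delta)$ from row $x$ to some row $y\in I^c$. (A1) $-L$ is an SDD $L_0$-matrix and, for each $\delta\in Z$, $\operatorname{Id}-B(\delta)$ is a WDD $L_0$-matrix. Restricted problem. For $v\in\mathbb R^G$, $v_D$ is its restriction to $D$; for a matrix $O$, $O_{IJ}$ is the submatrix with rows in $I$ and columns in $J$. Define $\tilde L=L_{DD}$, $\tilde f=f_D+L_{DD^c}w_{D^c}$, $\tilde Z=\prod_{x\in D}Z(x)$, and for $\tilde\delta\in\tilde Z$, $\tilde B(\tilde\delta)=B(\tilde\delta)_{DD}$ and $\tilde c(\tilde\delta)=c(\tilde\delta)-B(\tilde\delta)_{DD^c}w_{D^c}$ (rows indexed by $D$; well defined by row-decoupling), and $\tilde M\tilde v=\max_{\tilde\delta\in\tilde Z}\{\tilde B(\tilde\delta)\tilde v-\tilde c(\tilde\delta)\}$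 for $\tilde v\in\mathbb R^D$. Restricted strategies: $\tilde\Phi=\{\tilde\varphi=(I,\tilde\delta): I\subseteq G_{<0},\ \tilde\delta\in\tilde Z\}$; $|\tilde\Phi|$ is its cardinality. Policy iteration. For $\tilde\varphi=(I,\tilde\delta)\in\tilde\Phi$ let $\tilde\Psi\in\mathbb R^{D\times D}$ be the diagonal matrix with diagonal $\mathbf 1_I$, $\tilde{\operatorname{Id}}$ the identity of $\mathbb R^D$, and $$A(\tilde\varphi)=-(\tilde{\operatorname{Id}}-\tilde\Psi)\tilde L+\tilde\Psi(\tilde{\operatorname{Id}}-\tilde B(\tilde\delta)),\qquad b(\tilde\varphi)=(\tilde{\operatorname{Id}}-\tilde\Psi)\tilde f-\tilde\Psi\tilde c(\tilde\delta).$$ Given $\tilde v^k$, choose $\tilde\varphi^k\in\operatorname{argmax}_{\tilde\varphi\in\tilde\Phi}\{-A(\tilde\varphi)\tilde v^k+b(\tilde\varphi)\}$ (elementwise) and let $\tilde v^{k+1}$ be the solution of $A(\tilde\varphi^k)\tilde v^{k+1}=b(\tilde\varphi^k)$.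
   Formalization: The policy iteration convergence claim additionally assumes that for x in D with x ≥ 0, row x of B(δ) is the identity row (zero impulse changes nothing); without this it is false, e.g. G=D={0}, L=-1, f=-5, B=0, c=1, where v*=-1 but the iterates equal -5. *)

theory Defs
  imports Complex_Main "HOL-Library.FuncSet"
begin

text \<open>
  Vectors indexed by a finite set \<open>S\<close> are functions to the reals; where existence or uniqueness
  of a vector is at stake they are taken in \<open>\<real>\<^bsup>S\<^esup> = S \<rightarrow>\<^sub>E UNIV\<close>.  Matrices are functions of two
  indices.  The index sets are passed to the operations, so that the submatrix \<open>A\<^bsub>IJ\<^esub>\<close> is
  represented by \<open>A\<close> itself, read with rows in \<open>I\<close> and columns in \<open>J\<close>.
\<close>

type_synonym 'i vec = "'i \<Rightarrow> real"
type_synonym 'i mat = "'i \<Rightarrow> 'i \<Rightarrow> real"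

abbreviation vectors :: "'i set \<Rightarrow> 'i vec set" where
  "vectors S \<equiv> S \<rightarrow>\<^sub>E (UNIV :: real set)"

definition app :: "'i set \<Rightarrow> 'i mat \<Rightarrow> 'i vec \<Rightarrow> 'i vec" where
  "app J A v = (\<lambda>x. \<Sum>y\<in>J. A x y * v y)"

definition ident :: "'i mat" where
  "ident x y = (if x = y then 1 else 0)"


subsection \<open>Matrix notions\<close>

definition WDD :: "'i set \<Rightarrow> 'i mat \<Rightarrow> bool" where
  "WDD S A \<longleftrightarrow> (\<forall>i\<in>S. \<bar>A i i\<bar> \<ge> (\<Sum>j\<in>S - {i}. \<bar>A i j\<bar>))"

definition SDD :: "'i set \<Rightarrow> 'i mat \<Rightarrow> bool" where
  "SDD S A \<longleftrightarrow> (\<forall>i\<in>S. \<bar>A i i\<bar> > (\<Sum>j\<in>S - {i}. \<bar>A i j\<bar>))"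

definition L0_matrix :: "'i set \<Rightarrow> 'i mat \<Rightarrow> bool" where
  "L0_matrix S A \<longleftrightarrow> (\<forall>i\<in>S. A i i \<ge> 0 \<and> (\<forall>j\<in>S - {i}. A i j \<le> 0))"

text \<open>
  The edge set of the directed graph of a matrix.  A walk is a nonempty finite sequence of
  consecutive edges, so there is a walk from \<open>x\<close> to \<open>y\<close> iff \<open>(x, y) \<in> (graph S A)\<^sup>+\<close>.
\<close>

definition graph :: "'i set \<Rightarrow> 'i mat \<Rightarrow> ('i \<times> 'i) set" where
  "graph S A = {(i, j). i \<in> S \<and> j \<in> S \<and> A i j \<noteq> 0}"


subsection \<open>Grid, controls and operators\<close>

definition symmetric_grid :: "real set \<Rightarrow> bool" where
  "symmetric_grid G \<longleftrightarrow> (\<exists>(N::nat) (x::int \<Rightarrow> real).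
     strict_mono_on {- int N..int N} x \<and>
     (\<forall>i\<in>{- int N..int N}. x (- i) = - x i) \<and>
     G = x ` {- int N..int N})"

abbreviation neg_part :: "real set \<Rightarrow> real set" where
  "neg_part G \<equiv> {x\<in>G. x < 0}"

abbreviation nonpos_part :: "real set \<Rightarrow> real set" where
  "nonpos_part G \<equiv> {x\<in>G. x \<le> 0}"

text \<open>A control on \<open>S\<close> is an element of the product of the sets \<open>Z x\<close>, \<open>x \<in> S\<close>.\<close>

type_synonym control = "real \<Rightarrow> real"

abbreviation (input) controls :: "real set \<Rightarrow> (real \<Rightarrow> real set) \<Rightarrow> control set" where
  "controls S Z \<equiv> PiE S Z"

definition row_decoupled ::
  "real set \<Rightarrow> (real \<Rightarrow> real set) \<Rightarrow> (control \<Rightarrow> real mat) \<Rightarrow> (control \<Rightarrow> real vec) \<Rightarrow> bool" where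
  "row_decoupled G Z B c \<longleftrightarrow>
     (\<forall>\<delta>\<in>controls G Z. \<forall>\<delta>'\<in>controls G Z. \<forall>x\<in>G. \<delta> x = \<delta>' x \<longrightarrow>
        (\<forall>y\<in>G. B \<delta> x y = B \<delta>' x y) \<and> c \<delta> x = c \<delta>' x)"

definition impulse_op ::
  "real set \<Rightarrow> (real \<Rightarrow> real set) \<Rightarrow> (control \<Rightarrow> real mat) \<Rightarrow> (control \<Rightarrow> real vec) \<Rightarrow> real vec \<Rightarrow> real vec"
where
  "impulse_op S Z B c v = (\<lambda>x. Max ((\<lambda>\<delta>. app S (B \<delta>) v x - c \<delta> x) ` controls S Z))"

definition QVI_on ::
  "real set \<Rightarrow> real set \<Rightarrow> real mat \<Rightarrow> real vec \<Rightarrow> (real \<Rightarrow> real set) \<Rightarrow> (control \<Rightarrow> real mat) \<Rightarrow>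
   (control \<Rightarrow> real vec) \<Rightarrow> real vec \<Rightarrow> bool" where
  "QVI_on D S L f Z B c v \<longleftrightarrow>
     (\<forall>x\<in>D. max (app S L v x + f x) (impulse_op S Z B c v x - v x) = 0)"

text \<open>The strategies are \<open>strategies G G Z\<close>, the restricted ones \<open>strategies G D Z\<close>.\<close>

type_synonym strategy = "real set \<times> control"

definition strategies :: "real set \<Rightarrow> real set \<Rightarrow> (real \<Rightarrow> real set) \<Rightarrow> strategy set" where
  "strategies G S Z = Pow (neg_part G) \<times> controls S Z"

definition A0 :: "real set \<Rightarrow> (real \<Rightarrow> real set) \<Rightarrow> (control \<Rightarrow> real mat) \<Rightarrow> bool" where
  "A0 G Z B \<longleftrightarrow>
     (\<forall>(I, \<delta>)\<in>strategies G G Z. \<forall>x\<in>I. \<exists>y\<in>G - I. (x, y) \<in> (graph G (B \<delta>))\<^sup>+)"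

definition A1 ::
  "real set \<Rightarrow> real mat \<Rightarrow> (real \<Rightarrow> real set) \<Rightarrow> (control \<Rightarrow> real mat) \<Rightarrow> bool" where
  "A1 G L Z B \<longleftrightarrow>
     SDD G (\<lambda>x y. - L x y) \<and> L0_matrix G (\<lambda>x y. - L x y) \<and>
     (\<forall>\<delta>\<in>controls G Z. WDD G (\<lambda>x y. ident x y - B \<delta> x y) \<and>
                        L0_matrix G (\<lambda>x y. ident x y - B \<delta> x y))"


subsection \<open>Restricted problem\<close>

text \<open>
  If \<open>D\<close> contains the nonpositive grid points, then \<open>Z x = {0}\<close> off \<open>D\<close>, so the following is the
  only control on \<open>G\<close> that extends a given control on \<open>D\<close>.
\<close>

definition ext_control :: "real set \<Rightarrow> real set \<Rightarrow> control \<Rightarrow> control" where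
  "ext_control G D \<delta> = (\<lambda>x\<in>G. if x \<in> D then \<delta> x else 0)"

definition restr_f :: "real set \<Rightarrow> real set \<Rightarrow> real mat \<Rightarrow> real vec \<Rightarrow> real vec \<Rightarrow> real vec" where
  "restr_f G D L f w = (\<lambda>x. f x + app (G - D) L w x)"

definition restr_B ::
  "real set \<Rightarrow> real set \<Rightarrow> (control \<Rightarrow> real mat) \<Rightarrow> control \<Rightarrow> real mat" where
  "restr_B G D B \<delta> = B (ext_control G D \<delta>)"

definition restr_c ::
  "real set \<Rightarrow> real set \<Rightarrow> (control \<Rightarrow> real mat) \<Rightarrow> (control \<Rightarrow> real vec) \<Rightarrow> real vec \<Rightarrow>
   control \<Rightarrow> real vec" where
  "restr_c G D B c w \<delta> =
     (\<lambda>x. c (ext_control G D \<delta>) x - app (G - D) (B (ext_control G D \<delta>)) w x)"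


subsection \<open>Policy iteration\<close>

text \<open>
  \<open>of_bool (x \<in> I)\<close> is the diagonal entry in row \<open>x\<close> of \<open>\<Psi>\<close>, and multiplication by a diagonal
  matrix from the left scales the rows.
\<close>

definition policy_mat :: "real mat \<Rightarrow> (control \<Rightarrow> real mat) \<Rightarrow> strategy \<Rightarrow> real mat" where
  "policy_mat L B = (\<lambda>(I, \<delta>) x y.
     - (1 - of_bool (x \<in> I)) * L x y + of_bool (x \<in> I) * (ident x y - B \<delta> x y))"

definition policy_vec :: "real vec \<Rightarrow> (control \<Rightarrow> real vec) \<Rightarrow> strategy \<Rightarrow> real vec" where
  "policy_vec f c = (\<lambda>(I, \<delta>) x. (1 - of_bool (x \<in> I)) * f x - of_bool (x \<in> I) * c \<delta> x)"

definition policy_argmax ::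
  "real set \<Rightarrow> strategy set \<Rightarrow> (strategy \<Rightarrow> real mat) \<Rightarrow> (strategy \<Rightarrow> real vec) \<Rightarrow> real vec \<Rightarrow>
   strategy set" where
  "policy_argmax D \<Phi> A b v =
     {\<phi>\<in>\<Phi>. \<forall>\<psi>\<in>\<Phi>. \<forall>x\<in>D. - app D (A \<psi>) v x + b \<psi> x \<le> - app D (A \<phi>) v x + b \<phi> x}"

definition solves :: "real set \<Rightarrow> real mat \<Rightarrow> real vec \<Rightarrow> real vec \<Rightarrow> bool" where
  "solves D A b v \<longleftrightarrow> (\<forall>x\<in>D. app D A v x = b x)"

definition policy_iteration ::
  "real set \<Rightarrow> strategy set \<Rightarrow> (strategy \<Rightarrow> real mat) \<Rightarrow> (strategy \<Rightarrow> real vec) \<Rightarrow>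
   (nat \<Rightarrow> real vec) \<Rightarrow> bool" where
  "policy_iteration D \<Phi> A b v \<longleftrightarrow>
     (\<forall>k. v k \<in> vectors D) \<and>
     (\<forall>k. \<exists>\<phi>\<in>policy_argmax D \<Phi> A b (v k). solves D (A \<phi>) (b \<phi>) (v (Suc k)))"

text \<open>
  The sets \<open>Z x = {0}\<close> for \<open>x \<ge> 0\<close> stand for the absence of interventions there: the zero impulse
  leaves the state unchanged, i.e. row \<open>x\<close> of \<open>B \<delta>\<close> is that of the identity.  This does not follow
  from \<open>A0\<close> and \<open>A1\<close>.  As the strategies of policy iteration never intervene at \<open>x \<ge> 0\<close>, its limit
  can fail to solve the QVI without it: for \<open>G = D = {0}\<close>, \<open>L = -1\<close>, \<open>f = -5\<close>, \<open>B = 0\<close>, \<open>c = 1\<close> the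
  QVI reads \<open>max (-v - 5) (-1 - v) = 0\<close>, with solution \<open>-1\<close>, while policy iteration stops at \<open>-5\<close>.
\<close>

definition idle_on_nonneg ::
  "real set \<Rightarrow> real set \<Rightarrow> (real \<Rightarrow> real set) \<Rightarrow> (control \<Rightarrow> real mat) \<Rightarrow> bool" where
  "idle_on_nonneg G D Z B \<longleftrightarrow>
     (\<forall>\<delta>\<in>controls G Z. \<forall>x\<in>D. x \<ge> 0 \<longrightarrow> (\<forall>y\<in>G. B \<delta> x y = ident x y))"

end

theory Submission
  imports "Jordan_Normal_Form.Determinant" Defs
begin

text \<open>
  At each point of \<open>D\<close> the QVI is a maximum over finitely many affine options: no intervention, with a
  row of \<open>- L\<close>, or an intervention with control \<open>\<delta>\<close>, with a row of \<open>Id - B \<delta>\<close>.  All these rows are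
  weakly diagonally dominant with nonpositive off-diagonal entries; the rows of \<open>- L\<close> are strictly
  dominant, and the others come with a cost \<open>c \<delta> x > 0\<close>.

  Uniqueness (\<open>bellman_comparison\<close>).  Where the difference of a subsolution \<open>u\<close> and a supersolution
  attains a positive maximum, no strictly dominant row can be active for \<open>u\<close>, and the active rows
  form a closed system with row sums zero.  At the largest value of \<open>u\<close> in that set an intervention
  cannot increase the value, yet it costs \<open>c > 0\<close>: a contradiction.

  Existence (\<open>bellman_perron\<close>, \<open>bellman_unique_solution\<close>).  The pointwise supremum of all
  subsolutions solves the system.  Subsolutions exist, namely very negative constants, because \<open>- L\<close>
  is strictly dominant, and they are bounded above because at a positive maximum over \<open>G\<close> an
  intervention is not worth its cost.

  Restriction.  Vectors on \<open>D\<close> correspond to vectors on \<open>G\<close> that equal \<open>w\<close> off \<open>D\<close>, and the restricted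
  data are made so that all residuals agree under this correspondence (\<open>restricted_QVI_iff\<close>,
  \<open>policy_residual\<close>).  Hence every argument can take place on \<open>G\<close>, where row sums and costs are those
  of the original problem.

  Policy iteration.  For a single policy the closed set of maximum points consists of intervention
  points and thus contradicts the walks in the graph of \<open>B \<delta>\<close>, so policy matrices are monotone
  (\<open>policy_monotone\<close>), in particular invertible.  Howard's argument
  (\<open>policy_iteration_terminates\<close>) then gives increasing iterates which, there being finitely many
  policies, stop, and they can stop only at a vector whose best policy has residual zero.  As
  interventions are idle at nonnegative points, such a vector solves the QVI
  (\<open>policy_optimal_iff_QVI\<close>).
\<close>


section \<open>Maximum principle for diagonally dominant L0 matrices\<close>

lemma app_diff: "app G A (\<lambda>y. u y - v y) x = app G A u x - app G A v x"
  by (simp add: app_def right_diff_distrib sum_subtractf)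

lemma app_const: "app G A (\<lambda>_. K) x = (\<Sum>y\<in>G. A x y) * K"
  by (simp add: app_def sum_distrib_right)

text \<open>
  For an L0 matrix every term \<open>- A x y * (d x - d y)\<close> with \<open>y \<noteq> x\<close> is nonnegative where \<open>d\<close> is
  maximal, so this identity yields all the maximum principles below.
\<close>

lemma app_split_row_sum:
  assumes "finite G" "x \<in> G"
  shows "app G A d x = (\<Sum>y\<in>G. A x y) * d x + (\<Sum>y\<in>G - {x}. - A x y * (d x - d y))"
proof -
  have "app G A d x - (\<Sum>y\<in>G. A x y) * d x = (\<Sum>y\<in>G. - A x y * (d x - d y))"
    unfolding app_def sum_distrib_right sum_subtractf [symmetric]
    by (rule sum.cong) (simp_all add: algebra_simps)
  also have "\<dots> = (\<Sum>y\<in>G - {x}. - A x y * (d x - d y))"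
    using assms by (simp add: sum.remove)
  finally show ?thesis by simp
qed

lemma app_at_max_ge:
  assumes "finite G" "x \<in> G" "L0_matrix G A" "\<And>y. y \<in> G \<Longrightarrow> d y \<le> d x"
  shows "(\<Sum>y\<in>G. A x y) * d x \<le> app G A d x"
proof -
  have "0 \<le> (\<Sum>y\<in>G - {x}. - A x y * (d x - d y))"
  proof (rule sum_nonneg)
    fix y assume y: "y \<in> G - {x}"
    then have "A x y \<le> 0" using assms(2,3) by (auto simp: L0_matrix_def)
    moreover have "0 \<le> d x - d y" using assms(4) y by simp
    ultimately show "0 \<le> - A x y * (d x - d y)" by (simp add: mult_nonpos_nonneg)
  qed
  then show ?thesis using app_split_row_sum[OF assms(1,2)] by simp
qed

lemma row_sum_L0:
  assumes "finite G" "x \<in> G" "L0_matrix G A"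
  shows "(\<Sum>y\<in>G. A x y) = \<bar>A x x\<bar> - (\<Sum>y\<in>G - {x}. \<bar>A x y\<bar>)"
proof -
  have "(\<Sum>y\<in>G - {x}. \<bar>A x y\<bar>) = (\<Sum>y\<in>G - {x}. - A x y)"
    using assms(2,3) by (intro sum.cong) (auto simp: L0_matrix_def)
  then show ?thesis
    using assms by (simp add: sum.remove L0_matrix_def sum_negf)
qed

lemma row_sum_nonneg:
  assumes "finite G" "x \<in> G" "L0_matrix G A" "WDD G A"
  shows "0 \<le> (\<Sum>y\<in>G. A x y)"
  using row_sum_L0[OF assms(1-3)] assms(2,4) by (simp add: WDD_def)

lemma row_sum_pos:
  assumes "finite G" "x \<in> G" "L0_matrix G A" "SDD G A"
  shows "0 < (\<Sum>y\<in>G. A x y)"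
  using row_sum_L0[OF assms(1-3)] assms(2,4) by (simp add: SDD_def)

text \<open>
  At a positive maximum of \<open>d\<close> the row sum times \<open>d x\<close> is a lower bound for \<open>(A d) x\<close>, so
  \<open>(A d) x \<le> 0\<close> forces equality throughout: the row is not strictly dominant, and all its nonzero
  entries lie at points where the maximum is attained, too.  The matrix may depend on \<open>x\<close>.  Every
  comparison below is this alternative followed by the exclusion of such a closed set \<open>S\<close>.
\<close>

lemma positive_max_set:
  fixes d :: "'i vec"
  assumes fin: "finite G" and z: "z \<in> G" "0 < d z"
  shows "\<exists>S. S \<noteq> {} \<and> S \<subseteq> G \<and> (\<forall>x\<in>S. 0 < d x \<and>
    (\<forall>A. L0_matrix G A \<longrightarrow> 0 \<le> (\<Sum>y\<in>G. A x y) \<longrightarrow> app G A d x \<le> 0 \<longrightarrow>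
      (\<Sum>y\<in>G. A x y) = 0 \<and> (\<forall>y\<in>G. A x y \<noteq> 0 \<longrightarrow> y \<in> S)))"
proof -
  define m where "m = Max (d ` G)"
  define S where "S = {x \<in> G. d x = m}"
  have d_le: "d y \<le> m" if "y \<in> G" for y using fin that by (simp add: m_def)
  have m: "0 < m" using d_le[OF z(1)] z(2) by simp
  have "m \<in> d ` G" unfolding m_def using fin z by (intro Max_in) auto
  then have S: "S \<noteq> {}" "S \<subseteq> G" by (auto simp: S_def)
  have closed: "(\<Sum>y\<in>G. A x y) = 0 \<and> (\<forall>y\<in>G. A x y \<noteq> 0 \<longrightarrow> y \<in> S)"
    if x: "x \<in> S" and L0: "L0_matrix G A" and rs: "0 \<le> (\<Sum>y\<in>G. A x y)"
      and sub: "app G A d x \<le> 0" for A x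
  proof -
    have xG: "x \<in> G" and dx: "d x = m" using x by (auto simp: S_def)
    have max: "d y \<le> d x" if "y \<in> G" for y using d_le[OF that] dx by simp
    have "(\<Sum>y\<in>G. A x y) * d x \<le> 0"
      using app_at_max_ge[of G x A d, OF fin xG L0 max] sub by simp
    then have rs0: "(\<Sum>y\<in>G. A x y) = 0"
      using rs m dx by (simp add: mult_le_0_iff)
    have nonneg: "0 \<le> - A x y * (d x - d y)" if "y \<in> G - {x}" for y
    proof -
      have "A x y \<le> 0" using L0 that xG by (auto simp: L0_matrix_def)
      moreover have "0 \<le> d x - d y" using max that by simp
      ultimately show ?thesis by (simp add: mult_nonpos_nonneg)
    qed
    have "(\<Sum>y\<in>G - {x}. - A x y * (d x - d y)) \<le> 0"
      using app_split_row_sum[OF fin xG, of A d] rs0 sub by simp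
    then have "(\<Sum>y\<in>G - {x}. - A x y * (d x - d y)) = 0"
      by (intro antisym sum_nonneg nonneg)
    then have zero: "- A x y * (d x - d y) = 0" if "y \<in> G - {x}" for y
      using sum_nonneg_eq_0_iff[of "G - {x}" "\<lambda>y. - A x y * (d x - d y)"] fin nonneg that
      by blast
    have "y \<in> S" if "y \<in> G" "A x y \<noteq> 0" for y
      using zero[of y] that x dx by (cases "y = x") (auto simp: S_def)
    with rs0 show ?thesis by blast
  qed
  have "0 < d x" if "x \<in> S" for x using that m by (simp add: S_def)
  with S closed show ?thesis by (intro exI[of _ S]) blast
qed


section \<open>Bellman systems\<close>

text \<open>
  \<open>max\<^sub>k (b k - A k v) = 0\<close> on \<open>D\<close>, written without the maximum.  The rows range over \<open>D\<close> and the
  columns over a larger set \<open>G\<close>, on which \<open>v\<close> may carry boundary values.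
\<close>

definition bellman_on ::
  "'i set \<Rightarrow> 'i set \<Rightarrow> 'k set \<Rightarrow> ('k \<Rightarrow> 'i mat) \<Rightarrow> ('k \<Rightarrow> 'i vec) \<Rightarrow> 'i vec \<Rightarrow> bool" where
  "bellman_on D G K A b v \<longleftrightarrow>
     (\<forall>x\<in>D. (\<forall>k\<in>K. b k x \<le> app G (A k) v x) \<and> (\<exists>k\<in>K. app G (A k) v x = b k x))"

definition bellman_subsolution ::
  "'i set \<Rightarrow> 'i set \<Rightarrow> 'k set \<Rightarrow> ('k \<Rightarrow> 'i mat) \<Rightarrow> ('k \<Rightarrow> 'i vec) \<Rightarrow> 'i vec \<Rightarrow> bool" where
  "bellman_subsolution D G K A b v \<longleftrightarrow> (\<forall>x\<in>D. \<exists>k\<in>K. app G (A k) v x \<le> b k x)"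

lemma app_le_of_le_off_diagonal:
  assumes "finite G" "x \<in> G" "L0_matrix G A" "\<And>y. y \<in> G - {x} \<Longrightarrow> u y \<le> v y"
  shows "app G A v x \<le> app G A u x + A x x * (v x - u x)"
proof -
  have "(\<Sum>y\<in>G - {x}. A x y * v y) \<le> (\<Sum>y\<in>G - {x}. A x y * u y)"
    using assms by (intro sum_mono mult_left_mono_neg) (auto simp: L0_matrix_def)
  then show ?thesis
    using assms(1,2) by (simp add: app_def sum.remove algebra_simps)
qed

text \<open>
  Perron's method.  Raising \<open>v\<close> away from \<open>x\<close> only lowers \<open>(A k v) x\<close>, so the pointwise supremum of
  all subsolutions is again a subsolution; and if some inequality were strict at \<open>x\<close>, raising the
  value at \<open>x\<close> a little would give a larger subsolution.
\<close>

lemma bellman_perron: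
  fixes w :: "'i vec"
  assumes fin: "finite G" "finite K" "K \<noteq> {}" and DG: "D \<subseteq> G"
    and L0: "\<And>k. k \<in> K \<Longrightarrow> L0_matrix G (A k)"
    and ex: "bellman_subsolution D G K A b u0" "\<And>x. x \<in> G - D \<Longrightarrow> u0 x \<le> w x"
    and bdd: "\<And>u x. bellman_subsolution D G K A b u \<Longrightarrow> (\<And>x. x \<in> G - D \<Longrightarrow> u x \<le> w x) \<Longrightarrow>
      x \<in> D \<Longrightarrow> u x \<le> C"
  shows "\<exists>v. (\<forall>x\<in>G - D. v x = w x) \<and> bellman_on D G K A b v"
proof -
  define U where "U = {u. bellman_subsolution D G K A b u \<and> (\<forall>x\<in>G - D. u x \<le> w x)}"
  define v where "v = (\<lambda>x. if x \<in> D then Sup ((\<lambda>u. u x) ` U) else w x)"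
  have U0: "u0 \<in> U" using ex by (simp add: U_def)
  have bddU: "bdd_above ((\<lambda>u. u x) ` U)" if "x \<in> D" for x
    by (rule bdd_aboveI2[of _ _ C]) (use bdd that in \<open>simp add: U_def\<close>)
  have le_v: "u x \<le> v x" if "u \<in> U" "x \<in> G" for u x
    using that bddU[of x] by (cases "x \<in> D") (auto simp: v_def U_def intro!: cSUP_upper)
  have sub: "\<exists>k\<in>K. app G (A k) v x \<le> b k x" if x: "x \<in> D" for x
  proof (rule ccontr)
    assume "\<not> ?thesis"
    then have gap: "0 < app G (A k) v x - b k x" if "k \<in> K" for k using that by force
    \<comment> \<open>All options miss by at least \<open>\<gamma>\<close>, but for a subsolution within \<open>\<gamma> / R\<close> of \<open>v x\<close> one of them
      does not miss at all, and \<open>R\<close> bounds the slope of the change from there to \<open>v\<close>.\<close>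
    define \<gamma> where "\<gamma> = Min ((\<lambda>k. app G (A k) v x - b k x) ` K)"
    define R where "R = Max ((\<lambda>k. A k x x) ` K) + 1"
    have \<gamma>: "0 < \<gamma>" "\<And>k. k \<in> K \<Longrightarrow> \<gamma> \<le> app G (A k) v x - b k x"
      using fin gap by (auto simp: \<gamma>_def)
    have A_lt: "A k x x < R" if "k \<in> K" for k
    proof -
      have "A k x x \<le> Max ((\<lambda>k. A k x x) ` K)" using fin that by auto
      then show ?thesis by (simp add: R_def)
    qed
    have A_nonneg: "0 \<le> A k x x" if "k \<in> K" for k
      using L0[OF that] x DG by (auto simp: L0_matrix_def)
    have R: "0 < R" using A_lt A_nonneg fin(3) by force
    have "v x - \<gamma> / R < Sup ((\<lambda>u. u x) ` U)"
      using x \<gamma>(1) R by (simp add: v_def)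
    then obtain u where u: "u \<in> U" "v x - \<gamma> / R < u x"
      using less_cSUP_iff[of U "\<lambda>u. u x"] bddU[OF x] U0 by auto
    obtain k where k: "k \<in> K" "app G (A k) u x \<le> b k x"
      using u(1) x by (auto simp: U_def bellman_subsolution_def)
    have "app G (A k) v x \<le> app G (A k) u x + A k x x * (v x - u x)"
      using fin(1) x DG L0[OF k(1)] le_v[OF u(1)] by (intro app_le_of_le_off_diagonal) auto
    also have "\<dots> < b k x + \<gamma>"
    proof -
      have "A k x x * (v x - u x) \<le> A k x x * (\<gamma> / R)"
        using u(2) A_nonneg[OF k(1)] by (intro mult_left_mono) auto
      also have "\<dots> < R * (\<gamma> / R)"
        using A_lt[OF k(1)] \<gamma>(1) R by (intro mult_strict_right_mono) auto
      also have "\<dots> = \<gamma>" using R by simp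
      finally show ?thesis using k(2) by simp
    qed
    finally show False using \<gamma>(2)[OF k(1)] by simp
  qed
  have super: "b k x \<le> app G (A k) v x" if x: "x \<in> D" and k: "k \<in> K" for x k
  proof (rule ccontr)
    assume "\<not> ?thesis"
    then have gap: "0 < b k x - app G (A k) v x" by simp
    have A_nonneg: "0 \<le> A k x x" using L0[OF k] x DG by (auto simp: L0_matrix_def)
    \<comment> \<open>The summand 1 keeps the denominator positive, as \<open>A k x x\<close> may vanish.\<close>
    define \<epsilon> where "\<epsilon> = (b k x - app G (A k) v x) / (A k x x + 1)"
    have \<epsilon>: "0 < \<epsilon>" using gap A_nonneg by (simp add: \<epsilon>_def)
    have "(A k x x + 1) * \<epsilon> = b k x - app G (A k) v x"
      using A_nonneg by (simp add: \<epsilon>_def)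
    then have A\<epsilon>: "A k x x * \<epsilon> \<le> b k x - app G (A k) v x"
      using \<epsilon> by (simp add: algebra_simps)
    define v' where "v' = v(x := v x + \<epsilon>)"
    have xG: "x \<in> G" using x DG by auto
    have v': "app G (A k') v' y \<le> app G (A k') v y + A k' y x * \<epsilon>" for k' y
      using fin(1) xG by (simp add: v'_def app_def sum.remove[of G x] algebra_simps)
    have "bellman_subsolution D G K A b v'"
      unfolding bellman_subsolution_def
    proof
      fix y assume y: "y \<in> D"
      show "\<exists>k\<in>K. app G (A k) v' y \<le> b k y"
      proof (cases "y = x")
        case True
        then show ?thesis using v'[of k x] A\<epsilon> k by (intro bexI[of _ k]) auto
      next
        case False
        obtain k' where k': "k' \<in> K" "app G (A k') v y \<le> b k' y" using sub[OF y] by blast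
        have "A k' y x \<le> 0" using L0[OF k'(1)] y xG DG False by (auto simp: L0_matrix_def)
        then have "A k' y x * \<epsilon> \<le> 0" using \<epsilon> by (simp add: mult_nonpos_nonneg)
        then show ?thesis using v'[of k' y] k' by (intro bexI[of _ k']) auto
      qed
    qed
    moreover have "v' y \<le> w y" if "y \<in> G - D" for y
      using that x by (auto simp: v'_def v_def)
    ultimately have "v' \<in> U" by (simp add: U_def)
    from le_v[OF this xG] \<epsilon> show False by (simp add: v'_def)
  qed
  have "bellman_on D G K A b v"
    unfolding bellman_on_def using sub super by (blast intro: antisym)
  then show ?thesis by (intro exI[of _ v]) (auto simp: v_def)
qed

text \<open>
  A negative right-hand side \<open>b k x\<close> (a cost) makes up for the lack of strict dominance.  On the
  closed set where \<open>u - v\<close> attains a positive maximum, only such rows are used, they have row sum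
  zero and do not leave the set; hence at the largest value of \<open>u\<close> itself within that set
  \<open>(A k u) x \<ge> 0 > b k x\<close>, contradicting that \<open>u\<close> is a subsolution.
\<close>

lemma bellman_comparison:
  fixes u v :: "'i vec"
  assumes fin: "finite G" and DG: "D \<subseteq> G"
    and L0: "\<And>k. k \<in> K \<Longrightarrow> L0_matrix G (A k)"
    and rs: "\<And>k x. k \<in> K \<Longrightarrow> x \<in> D \<Longrightarrow> 0 \<le> (\<Sum>y\<in>G. A k x y)"
    and cost: "\<And>k x. k \<in> K \<Longrightarrow> x \<in> D \<Longrightarrow> 0 < (\<Sum>y\<in>G. A k x y) \<or> b k x < 0"
    and sub: "bellman_subsolution D G K A b u"
    and super: "\<And>k x. k \<in> K \<Longrightarrow> x \<in> D \<Longrightarrow> b k x \<le> app G (A k) v x"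
    and bd: "\<And>x. x \<in> G - D \<Longrightarrow> u x \<le> v x" and z: "z \<in> G"
  shows "u z \<le> v z"
proof (rule ccontr)
  assume not_le: "\<not> ?thesis"
  define d where "d = (\<lambda>x. u x - v x)"
  have "0 < d z" using not_le by (simp add: d_def)
  from positive_max_set[where d = d, OF fin z this] obtain S where S_ne: "S \<noteq> {}" and SG: "S \<subseteq> G" and pos: "\<And>x. x \<in> S \<Longrightarrow> 0 < d x"
    and max: "\<And>A x. x \<in> S \<Longrightarrow> L0_matrix G A \<Longrightarrow> 0 \<le> (\<Sum>y\<in>G. A x y) \<Longrightarrow> app G A d x \<le> 0 \<Longrightarrow>
      (\<Sum>y\<in>G. A x y) = 0 \<and> (\<forall>y\<in>G. A x y \<noteq> 0 \<longrightarrow> y \<in> S)"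
    by metis
  have S: "x \<in> G" "x \<in> D" if "x \<in> S" for x
    using that pos[OF that] SG bd[of x] by (auto simp: d_def)
  have closed: "\<exists>k\<in>K. app G (A k) u x \<le> b k x \<and> (\<Sum>y\<in>G. A k x y) = 0 \<and>
      (\<forall>y\<in>G. A k x y \<noteq> 0 \<longrightarrow> y \<in> S)" if x: "x \<in> S" for x
  proof -
    obtain k where k: "k \<in> K" "app G (A k) u x \<le> b k x"
      using sub S[OF x] by (auto simp: bellman_subsolution_def)
    have "app G (A k) d x \<le> 0"
      using k super[OF k(1) S(2)[OF x]] by (simp add: d_def app_diff)
    with max[OF x L0[OF k(1)] rs[OF k(1) S(2)[OF x]]] k show ?thesis by blast
  qed
  have finS: "finite S" using SG fin by (rule finite_subset)
  then have "Max (u ` S) \<in> u ` S" using S_ne by (intro Max_in) auto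
  then obtain x where x: "x \<in> S" "u x = Max (u ` S)" by auto
  have u_le: "u y \<le> u x" if "y \<in> S" for y using that x finS by simp
  obtain k where k: "k \<in> K" "app G (A k) u x \<le> b k x" "(\<Sum>y\<in>G. A k x y) = 0"
      "\<And>y. y \<in> G \<Longrightarrow> A k x y \<noteq> 0 \<Longrightarrow> y \<in> S"
    using closed[OF x(1)] by blast
  have "app G (A k) u x = (\<Sum>y\<in>G - {x}. - A k x y * (u x - u y))"
    using app_split_row_sum[OF fin S(1)[OF x(1)]] k(3) by simp
  also have "\<dots> \<ge> 0"
  proof (rule sum_nonneg)
    fix y assume y: "y \<in> G - {x}"
    show "0 \<le> - A k x y * (u x - u y)"
    proof (cases "A k x y = 0")
      case False
      then have "0 \<le> u x - u y" using k(4)[of y] y u_le by auto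
      moreover have "A k x y \<le> 0" using L0[OF k(1)] y S(1)[OF x(1)] by (auto simp: L0_matrix_def)
      ultimately show ?thesis by (simp add: mult_nonpos_nonneg)
    qed simp
  qed
  finally have "0 \<le> b k x" using k(2) by simp
  with cost[OF k(1) S(2)[OF x(1)]] k(3) show False by simp
qed

text \<open>
  Constants serve as barriers for Perron's method.  Let \<open>C\<close> be at least \<open>\<bar>w\<bar>\<close> and at least \<open>\<bar>b k x\<bar>\<close>
  divided by the row sum, wherever that is positive.  Then \<open>- C\<close> is a subsolution by option \<open>k0\<close>,
  and no subsolution exceeds \<open>C\<close>: at its maximum, a strictly dominant row is excluded by the choice
  of \<open>C\<close> and any other row by \<open>b k x < 0\<close>.
\<close>

theorem bellman_unique_solution:
  fixes w :: "'i vec"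
  assumes fin: "finite G" "finite K" and DG: "D \<subseteq> G"
    and L0: "\<And>k. k \<in> K \<Longrightarrow> L0_matrix G (A k)"
    and rs: "\<And>k x. k \<in> K \<Longrightarrow> x \<in> D \<Longrightarrow> 0 \<le> (\<Sum>y\<in>G. A k x y)"
    and cost: "\<And>k x. k \<in> K \<Longrightarrow> x \<in> D \<Longrightarrow> 0 < (\<Sum>y\<in>G. A k x y) \<or> b k x < 0"
    and k0: "k0 \<in> K" "\<And>x. x \<in> D \<Longrightarrow> 0 < (\<Sum>y\<in>G. A k0 x y)"
  shows "\<exists>!v. v \<in> vectors G \<and> bellman_on D G K A b v \<and> (\<forall>x\<in>G - D. v x = w x)"
proof -
  define ratio where "ratio = (\<lambda>(k, x). \<bar>b k x\<bar> / (\<Sum>y\<in>G. A k x y))"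
  define C where "C = Max ((insert 0 (ratio ` (K \<times> D)) \<union> (\<lambda>x. \<bar>w x\<bar>) ` G))"
  have finD: "finite D" using DG fin(1) finite_subset by blast
  have finC: "finite (insert 0 (ratio ` (K \<times> D)) \<union> (\<lambda>x. \<bar>w x\<bar>) ` G)"
    using fin finD by auto
  have C0: "0 \<le> C" using finC by (simp add: C_def)
  have Cw: "\<bar>w x\<bar> \<le> C" if "x \<in> G" for x using finC that unfolding C_def by (intro Max_ge) auto
  have Cb: "\<bar>b k x\<bar> \<le> (\<Sum>y\<in>G. A k x y) * C"
    if "k \<in> K" "x \<in> D" "0 < (\<Sum>y\<in>G. A k x y)" for k x
  proof -
    have "ratio (k, x) \<le> C" using finC that unfolding C_def by (intro Max_ge) auto
    then show ?thesis using that(3) by (simp add: ratio_def field_simps)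
  qed
  have subC: "bellman_subsolution D G K A b (\<lambda>_. - C)"
    unfolding bellman_subsolution_def app_const
  proof
    fix x assume "x \<in> D"
    then show "\<exists>k\<in>K. (\<Sum>y\<in>G. A k x y) * - C \<le> b k x"
      using Cb[OF k0(1) _ k0(2), of x] k0(1) by (intro bexI[of _ k0]) auto
  qed
  have sub_le: "u x \<le> C" if u: "bellman_subsolution D G K A b u"
    and bd: "\<And>x. x \<in> G - D \<Longrightarrow> u x \<le> w x" and x: "x \<in> D" for u x
  proof (rule ccontr)
    assume gt: "\<not> u x \<le> C"
    have "Max (u ` G) \<in> u ` G" using fin x DG by (intro Max_in) auto
    then obtain p where p: "p \<in> G" "u p = Max (u ` G)" by auto
    have u_le: "u y \<le> u p" if "y \<in> G" for y using p fin that by simp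
    have up: "C < u p" using gt u_le[of x] x DG by auto
    then have pD: "p \<in> D" using bd[of p] Cw[of p] p(1) by force
    obtain k where k: "k \<in> K" "app G (A k) u p \<le> b k p"
      using u pD by (auto simp: bellman_subsolution_def)
    have *: "(\<Sum>y\<in>G. A k p y) * u p \<le> b k p"
      using app_at_max_ge[of G p "A k" u, OF fin(1) p(1) L0[OF k(1)] u_le] k(2) by simp
    show False
    proof (cases "0 < (\<Sum>y\<in>G. A k p y)")
      case True
      then have "(\<Sum>y\<in>G. A k p y) * C < (\<Sum>y\<in>G. A k p y) * u p" using up by simp
      then show False using * Cb[OF k(1) pD True] by simp
    next
      case False
      then have "b k p < 0" using cost[OF k(1) pD] by simp
      moreover have "0 \<le> (\<Sum>y\<in>G. A k p y) * u p"
        using rs[OF k(1) pD] up C0 by simp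
      ultimately show False using * by simp
    qed
  qed
  have "- C \<le> w x" if "x \<in> G - D" for x using Cw[of x] that by auto
  then have "\<exists>v. (\<forall>x\<in>G - D. v x = w x) \<and> bellman_on D G K A b v"
    using k0(1) by (intro bellman_perron[OF fin _ DG L0 subC, where C = C] sub_le) auto
  then obtain v where v: "\<forall>x\<in>G - D. v x = w x" "bellman_on D G K A b v" by blast
  have app_restrict: "app G M (restrict v G) x = app G M v x" for M :: "'i mat" and x
    by (simp add: app_def)
  have ex: "restrict v G \<in> vectors G \<and> bellman_on D G K A b (restrict v G) \<and>
      (\<forall>x\<in>G - D. restrict v G x = w x)"
    using v by (simp add: bellman_on_def app_restrict)
  have le: "u x \<le> u' x"
    if "bellman_on D G K A b u \<and> (\<forall>x\<in>G - D. u x = w x)"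
      "bellman_on D G K A b u' \<and> (\<forall>x\<in>G - D. u' x = w x)" "x \<in> G" for u u' x
  proof (rule bellman_comparison[OF fin(1) DG L0 rs cost])
    show "bellman_subsolution D G K A b u"
      using that(1) unfolding bellman_on_def bellman_subsolution_def by (metis order_refl)
  qed (use that in \<open>auto simp: bellman_on_def\<close>)
  show ?thesis
  proof (rule ex1I[of _ "restrict v G"], rule ex)
    fix u assume u: "u \<in> vectors G \<and> bellman_on D G K A b u \<and> (\<forall>x\<in>G - D. u x = w x)"
    show "u = restrict v G"
      by (rule PiE_ext[of _ G "\<lambda>_. UNIV"]) (use u ex v(2) in \<open>auto intro!: antisym le\<close>)
  qed
qed


section \<open>Square linear systems\<close>

text \<open>Transport of the determinant criterion along an enumeration of the index set.\<close>

lemma solvable_if_injective: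
  fixes A :: "'i mat" and b :: "'i vec"
  assumes fin: "finite S"
    and inj: "\<And>v. (\<And>x. x \<in> S \<Longrightarrow> app S A v x = 0) \<Longrightarrow> (\<And>x. x \<in> S \<Longrightarrow> v x = 0)"
  shows "\<exists>v. \<forall>x\<in>S. app S A v x = b x"
proof -
  obtain e where e: "bij_betw e {0..<card S} S" using ex_bij_betw_nat_finite[OF fin] by blast
  define n where "n = card S"
  define i where "i = the_inv_into {0..<n} e"
  have e_in: "e j \<in> S" and ie: "i (e j) = j" if "j < n" for j
    using that e by (auto simp: n_def i_def bij_betw_def the_inv_into_f_f)
  have i_in: "i x < n" and ei: "e (i x) = x" if "x \<in> S" for x
    using that e the_inv_into_into[of e "{0..<n}" x "{0..<n}"] f_the_inv_into_f[of e "{0..<n}" x]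
    by (auto simp: n_def i_def bij_betw_def)
  define M where "M = Matrix.mat n n (\<lambda>(j, k). A (e j) (e k))"
  have M: "M \<in> carrier_mat n n" by (simp add: M_def)
  have row: "(M *\<^sub>v V) $ j = app S A (\<lambda>x. V $ i x) (e j)"
    if "V \<in> carrier_vec n" "j < n" for V j
  proof -
    have "(M *\<^sub>v V) $ j = (\<Sum>k\<in>{0..<n}. A (e j) (e k) * V $ k)"
      using that by (simp add: M_def scalar_prod_def)
    also have "\<dots> = (\<Sum>k\<in>{0..<n}. A (e j) (e k) * V $ i (e k))"
      by (simp add: ie)
    also have "\<dots> = (\<Sum>x\<in>S. A (e j) x * V $ i x)"
      using e by (intro sum.reindex_bij_betw) (simp add: n_def)
    finally show ?thesis by (simp add: app_def)
  qed
  have "det M \<noteq> 0"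
  proof
    assume "det M = 0"
    then obtain V where V: "V \<in> carrier_vec n" "V \<noteq> 0\<^sub>v n" "M *\<^sub>v V = 0\<^sub>v n"
      using det_0_iff_vec_prod_zero[OF M] by blast
    have "app S A (\<lambda>x. V $ i x) x = 0" if "x \<in> S" for x
      using row[OF V(1) i_in[OF that]] V(3) i_in[OF that] ei[OF that] by simp
    then have "V $ i x = 0" if "x \<in> S" for x using inj that by blast
    then have "V $ j = 0" if "j < n" for j using e_in[OF that] ie[OF that] by metis
    then show False using V(1,2) by (auto intro: eq_vecI)
  qed
  then obtain N where N: "N \<in> carrier_mat n n" "M * N = 1\<^sub>m n"
    using det_non_zero_imp_unit[OF M, of "()"] by (auto simp: Units_def ring_mat_def)
  define \<beta> where "\<beta> = Matrix.vec n (\<lambda>j. b (e j))"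
  have \<beta>: "\<beta> \<in> carrier_vec n" by (simp add: \<beta>_def)
  have "M *\<^sub>v (N *\<^sub>v \<beta>) = \<beta>"
    using M N \<beta> assoc_mult_mat_vec[of M n n N n \<beta>] by simp
  then have "app S A (\<lambda>x. (N *\<^sub>v \<beta>) $ i x) x = b x" if "x \<in> S" for x
    using row[of "N *\<^sub>v \<beta>" "i x"] N(1) \<beta> i_in[OF that] ei[OF that] by (simp add: \<beta>_def)
  then show ?thesis by blast
qed


section \<open>Policy iteration for monotone matrices\<close>

text \<open>
  Howard's argument.  Maximality gives \<open>A (\<phi> (k + 1)) u\<^sub>k\<^sub>+\<^sub>1 \<le> b (\<phi> (k + 1)) = A (\<phi> (k + 1)) u\<^sub>k\<^sub>+\<^sub>2\<close>, so
  by monotonicity the iterates increase from the first on.  As an iterate is determined by the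
  preceding policy, a repeated policy means a repeated iterate; by monotonicity the iterates then
  stall, which happens only at the solution.
\<close>

theorem policy_iteration_terminates:
  assumes fin: "finite \<Phi>"
    and mono: "\<And>\<phi> u v x. \<phi> \<in> \<Phi> \<Longrightarrow> (\<And>x. x \<in> D \<Longrightarrow> app D (A \<phi>) u x \<le> app D (A \<phi>) v x) \<Longrightarrow>
      x \<in> D \<Longrightarrow> u x \<le> v x"
    and opt: "\<And>u \<phi>. u \<in> vectors D \<Longrightarrow> \<phi> \<in> policy_argmax D \<Phi> A b u \<Longrightarrow>
      solves D (A \<phi>) (b \<phi>) u \<longleftrightarrow> u = vstar"
    and pol: "policy_iteration D \<Phi> A b u"
  shows "\<exists>K\<le>card \<Phi>. \<forall>k\<ge>K. u k = vstar"
proof -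
  have vec: "u k \<in> vectors D" for k using pol by (simp add: policy_iteration_def)
  obtain \<phi> where arg: "\<And>k. \<phi> k \<in> policy_argmax D \<Phi> A b (u k)"
    and sol: "\<And>k. solves D (A (\<phi> k)) (b (\<phi> k)) (u (Suc k))"
    using pol unfolding policy_iteration_def by metis
  have \<Phi>: "\<phi> k \<in> \<Phi>" for k using arg[of k] by (simp add: policy_argmax_def)
  have unique: "v = v'" if "\<psi> \<in> \<Phi>" "solves D (A \<psi>) (b \<psi>) v" "solves D (A \<psi>) (b \<psi>) v'"
    "v \<in> vectors D" "v' \<in> vectors D" for \<psi> v v'
  proof (rule PiE_ext[of _ D "\<lambda>_. UNIV"])
    show "v x = v' x" if "x \<in> D" for x
      using mono[OF \<open>\<psi> \<in> \<Phi>\<close> _ that] \<open>solves D (A \<psi>) (b \<psi>) v\<close> \<open>solves D (A \<psi>) (b \<psi>) v'\<close>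
      by (intro antisym) (simp_all add: solves_def)
  qed fact+
  have stay: "u (Suc k) = vstar" if "u k = vstar" for k
    using opt[OF vec arg] that unique[OF \<Phi> sol _ vec vec] by metis
  have incr: "u (Suc k) x \<le> u (Suc (Suc k)) x" if "x \<in> D" for k x
  proof (rule mono[OF \<Phi> _ that])
    fix y assume y: "y \<in> D"
    have "- app D (A (\<phi> k)) (u (Suc k)) y + b (\<phi> k) y
        \<le> - app D (A (\<phi> (Suc k))) (u (Suc k)) y + b (\<phi> (Suc k)) y"
      using arg[of "Suc k"] \<Phi> y by (simp add: policy_argmax_def)
    then show "app D (A (\<phi> (Suc k))) (u (Suc k)) y \<le> app D (A (\<phi> (Suc k))) (u (Suc (Suc k))) y"
      using sol y by (simp add: solves_def)
  qed
  have "\<not> inj_on \<phi> {..card \<Phi>}"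
    using card_inj_on_le[of \<phi> "{..card \<Phi>}" \<Phi>] fin \<Phi> by auto
  then obtain i j where ij: "i < j" "j \<le> card \<Phi>" "\<phi> i = \<phi> j"
    unfolding inj_on_def by (metis atMost_iff linorder_neqE_nat)
  have eq: "u (Suc i) = u (Suc j)"
    using unique[OF \<Phi> sol[of i] _ vec vec] sol[of j] ij(3) by simp
  have "u (Suc (Suc i)) = u (Suc i)"
  proof (rule PiE_ext[of _ D "\<lambda>_. UNIV"])
    fix x assume x: "x \<in> D"
    have "u (Suc (Suc i)) x \<le> u (Suc j) x"
      using lift_Suc_mono_le[of "\<lambda>k. u (Suc k) x"] incr[OF x] ij(1) by (metis Suc_leI)
    then show "u (Suc (Suc i)) x = u (Suc i) x" using eq incr[OF x, of i] by simp
  qed (rule vec)+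
  then have start: "u (Suc i) = vstar" using opt[OF vec arg] sol by metis
  have "u k = vstar" if "Suc i \<le> k" for k
    using that by (induction k rule: dec_induct) (simp_all only: start stay)
  then show ?thesis using ij by (intro exI[of _ "Suc i"]) auto
qed


section \<open>The QVI as a Bellman system\<close>

text \<open>The two alternatives of the QVI: no intervention, or an intervention with a given control.\<close>

primrec option_mat :: "real mat \<Rightarrow> (control \<Rightarrow> real mat) \<Rightarrow> control option \<Rightarrow> real mat" where
  "option_mat L B None = (\<lambda>x y. - L x y)"
| "option_mat L B (Some \<delta>) = (\<lambda>x y. ident x y - B \<delta> x y)"

primrec option_vec :: "real vec \<Rightarrow> (control \<Rightarrow> real vec) \<Rightarrow> control option \<Rightarrow> real vec" where
  "option_vec f c None = f"
| "option_vec f c (Some \<delta>) = (\<lambda>x. - c \<delta> x)"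

definition option_residual ::
  "real set \<Rightarrow> real mat \<Rightarrow> real vec \<Rightarrow> (control \<Rightarrow> real mat) \<Rightarrow> (control \<Rightarrow> real vec) \<Rightarrow>
   control option \<Rightarrow> real vec \<Rightarrow> real vec" where
  "option_residual G L f B c k v x = option_vec f c k x - app G (option_mat L B k) v x"

lemma app_ident_diff:
  assumes "finite G" "x \<in> G"
  shows "app G (\<lambda>x y. ident x y - B x y) v x = v x - app G B v x"
proof -
  have "(\<Sum>y\<in>G. ident x y * v y) = (\<Sum>y\<in>G. if y = x then v y else 0)"
    by (intro sum.cong) (auto simp: ident_def)
  also have "\<dots> = v x" using assms by simp
  finally show ?thesis by (simp add: app_def left_diff_distrib sum_subtractf)
qed

lemma option_residual_None: "option_residual G L f B c None v x = app G L v x + f x"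
  by (simp add: option_residual_def app_def sum_negf)

lemma option_residual_Some:
  assumes "finite G" "x \<in> G"
  shows "option_residual G L f B c (Some \<delta>) v x = app G (B \<delta>) v x - c \<delta> x - v x"
  using assms by (simp add: option_residual_def app_ident_diff)

lemma max_Max_eq_0_iff:
  fixes a r :: real
  assumes "finite T" "T \<noteq> {}"
  shows "max a (Max T - r) = 0 \<longleftrightarrow> a \<le> 0 \<and> (\<forall>t\<in>T. t - r \<le> 0) \<and> (a = 0 \<or> (\<exists>t\<in>T. t - r = 0))"
proof -
  have Max: "Max T \<in> T" using assms by simp
  have le: "(\<forall>t\<in>T. t - r \<le> 0) \<longleftrightarrow> Max T - r \<le> 0"
    using assms by simp
  have eq: "(\<exists>t\<in>T. t - r = 0) \<longleftrightarrow> Max T - r = 0" if "Max T - r \<le> 0"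
  proof
    assume "\<exists>t\<in>T. t - r = 0"
    then obtain t where "t \<in> T" "t - r = 0" by blast
    then show "Max T - r = 0" using that Max_ge[OF assms(1), of t] by simp
  qed (use Max in blast)
  have "max a (Max T - r) = 0 \<longleftrightarrow> a \<le> 0 \<and> Max T - r \<le> 0 \<and> (a = 0 \<or> Max T - r = 0)"
    by (auto simp: max_def)
  then show ?thesis using le eq by blast
qed


section \<open>Restriction to the unconstrained points\<close>

text \<open>The inverse of restriction to \<open>D\<close> among the vectors with prescribed values \<open>w\<close> off \<open>D\<close>.\<close>

definition boundary_ext :: "real set \<Rightarrow> real set \<Rightarrow> real vec \<Rightarrow> real vec \<Rightarrow> real vec" where
  "boundary_ext G D w u = (\<lambda>x\<in>G. if x \<in> D then u x else w x)"

lemma app_boundary_ext: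
  assumes "finite G" "D \<subseteq> G"
  shows "app G A (boundary_ext G D w u) x = app D A u x + app (G - D) A w x"
proof -
  have "app G A (boundary_ext G D w u) x =
      app (G - D) A (boundary_ext G D w u) x + app D A (boundary_ext G D w u) x"
    unfolding app_def using assms by (intro sum.subset_diff)
  moreover have "app (G - D) A (boundary_ext G D w u) x = app (G - D) A w x"
    unfolding app_def by (intro sum.cong) (auto simp: boundary_ext_def)
  moreover have "app D A (boundary_ext G D w u) x = app D A u x"
    unfolding app_def using assms(2) by (intro sum.cong) (auto simp: boundary_ext_def)
  ultimately show ?thesis by simp
qed

locale impulse_qvi =
  fixes G :: "real set" and L :: "real mat" and f :: "real vec"
    and Z :: "real \<Rightarrow> real set" and B :: "control \<Rightarrow> real mat" and c :: "control \<Rightarrow> real vec"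
    and D :: "real set" and w :: "real vec"
  assumes finite_G: "finite G"
    and Z_finite: "x \<in> G \<Longrightarrow> finite (Z x) \<and> Z x \<noteq> {}"
    and c_pos: "\<delta> \<in> controls G Z \<Longrightarrow> x \<in> G \<Longrightarrow> c \<delta> x > 0"
    and decoupled: "row_decoupled G Z B c"
    and A0: "A0 G Z B"
    and A1: "A1 G L Z B"
    and D_subset: "D \<subseteq> G"
    and neg_subset: "neg_part G \<subseteq> D"
    and Z_complement: "x \<in> G - D \<Longrightarrow> Z x = {0}"
begin

abbreviation "options \<equiv> insert None (Some ` controls G Z)"

abbreviation "residual \<equiv> option_residual G L f B c"

abbreviation "prolong \<equiv> boundary_ext G D w"

abbreviation "f' \<equiv> restr_f G D L f w"

abbreviation "B' \<equiv> restr_B G D B"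

abbreviation "c' \<equiv> restr_c G D B c w"

abbreviation "\<Phi>' \<equiv> strategies G D Z"

abbreviation "pmat \<equiv> policy_mat L B'"

abbreviation "pvec \<equiv> policy_vec f' c'"

lemma finite_D: "finite D"
  using D_subset finite_G by (rule finite_subset)

lemma controls_finite: "finite (controls G Z)" and controls_nonempty: "controls G Z \<noteq> {}"
  using finite_G Z_finite by (auto intro!: finite_PiE simp: PiE_eq_empty_iff)

lemma finite_strategies: "finite \<Phi>'"
  using finite_G finite_D D_subset Z_finite
  by (auto simp: strategies_def intro!: finite_PiE finite_cartesian_product)

lemma option_L0: "k \<in> options \<Longrightarrow> L0_matrix G (option_mat L B k)"
  using A1 by (auto simp: A1_def)

lemma option_row_sum_nonneg:
  assumes "k \<in> options" "x \<in> G"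
  shows "0 \<le> (\<Sum>y\<in>G. option_mat L B k x y)"
proof (cases k)
  case None
  then show ?thesis
    using A1 row_sum_pos[OF finite_G assms(2), of "\<lambda>x y. - L x y"] by (simp add: A1_def)
next
  case (Some \<delta>)
  then show ?thesis
    using A1 assms row_sum_nonneg[OF finite_G assms(2), of "\<lambda>x y. ident x y - B \<delta> x y"]
    by (auto simp: A1_def)
qed

lemma None_row_sum_pos: "x \<in> G \<Longrightarrow> 0 < (\<Sum>y\<in>G. option_mat L B None x y)"
  using A1 row_sum_pos[OF finite_G, of x "\<lambda>x y. - L x y"] by (simp add: A1_def)

lemma QVI_iff_residual:
  "QVI_on D G L f Z B c v \<longleftrightarrow>
    (\<forall>x\<in>D. (\<forall>k\<in>options. residual k v x \<le> 0) \<and> (\<exists>k\<in>options. residual k v x = 0))"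
proof -
  have "max (app G L v x + f x) (impulse_op G Z B c v x - v x) = 0 \<longleftrightarrow>
    (\<forall>k\<in>options. residual k v x \<le> 0) \<and> (\<exists>k\<in>options. residual k v x = 0)" if "x \<in> D" for x
  proof -
    have "x \<in> G" using that D_subset by blast
    from option_residual_Some[OF finite_G this]
    have Some: "residual (Some \<delta>) v x = app G (B \<delta>) v x - c \<delta> x - v x" for \<delta> by blast
    let ?T = "(\<lambda>\<delta>. app G (B \<delta>) v x - c \<delta> x) ` controls G Z"
    have "finite ?T" "?T \<noteq> {}" using controls_finite controls_nonempty by auto
    then show ?thesis
      unfolding impulse_op_def max_Max_eq_0_iff[OF \<open>finite ?T\<close> \<open>?T \<noteq> {}\<close>] ball_simps bex_simps
        option_residual_None Some by blast
  qed
  then show ?thesis by (simp add: QVI_on_def)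
qed

lemma QVI_iff_bellman:
  "QVI_on D G L f Z B c v \<longleftrightarrow> bellman_on D G options (option_mat L B) (option_vec f c) v"
  unfolding QVI_iff_residual bellman_on_def option_residual_def diff_le_0_iff_le
    right_minus_eq
  by (simp only: eq_commute)

lemma constrained_QVI_unique:
  "\<exists>!v. v \<in> vectors G \<and> QVI_on D G L f Z B c v \<and> (\<forall>x\<in>G - D. v x = w x)"
  unfolding QVI_iff_bellman
proof (rule bellman_unique_solution[OF finite_G _ D_subset option_L0])
  show "finite options" using controls_finite by simp
  show "0 \<le> (\<Sum>y\<in>G. option_mat L B k x y)" if "k \<in> options" "x \<in> D" for k x
    using that D_subset by (intro option_row_sum_nonneg) auto
  show "0 < (\<Sum>y\<in>G. option_mat L B k x y) \<or> option_vec f c k x < 0"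
    if "k \<in> options" "x \<in> D" for k x
    using that D_subset None_row_sum_pos[of x] c_pos[of _ x] by auto
  show "None \<in> options" by simp
  show "0 < (\<Sum>y\<in>G. option_mat L B None x y)" if "x \<in> D" for x
    using that D_subset None_row_sum_pos by auto
qed

lemma ext_control_apply: "x \<in> D \<Longrightarrow> ext_control G D \<delta> x = \<delta> x"
  using D_subset by (auto simp: ext_control_def)

lemma ext_control_in: "\<delta> \<in> controls D Z \<Longrightarrow> ext_control G D \<delta> \<in> controls G Z"
  using Z_complement by (auto simp: ext_control_def PiE_iff)

lemma ext_control_restrict:
  assumes "\<delta> \<in> controls G Z"
  shows "restrict \<delta> D \<in> controls D Z" "ext_control G D (restrict \<delta> D) = \<delta>"
proof -
  show "restrict \<delta> D \<in> controls D Z" using assms D_subset by (auto simp: PiE_iff)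
  show "ext_control G D (restrict \<delta> D) = \<delta>"
  proof
    fix x
    show "ext_control G D (restrict \<delta> D) x = \<delta> x"
    proof (cases "x \<in> G")
      case True
      then show ?thesis
        using PiE_mem[OF assms True] Z_complement[of x] by (auto simp: ext_control_def)
    next
      case False
      then show ?thesis using PiE_arb[OF assms False] by (simp add: ext_control_def)
    qed
  qed
qed

lemma ext_control_image: "ext_control G D ` controls D Z = controls G Z"
proof
  show "controls G Z \<subseteq> ext_control G D ` controls D Z"
    using ext_control_restrict by (metis image_eqI subsetI)
qed (use ext_control_in in blast)

lemma prolong_in: "prolong u \<in> vectors G"
  by (simp add: boundary_ext_def)

lemma prolong_apply: "x \<in> D \<Longrightarrow> prolong u x = u x"
  using D_subset by (auto simp: boundary_ext_def)

lemma prolong_complement: "x \<in> G - D \<Longrightarrow> prolong u x = w x"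
  by (simp add: boundary_ext_def)

lemma restrict_prolong: "u \<in> vectors D \<Longrightarrow> restrict (prolong u) D = u"
  by (rule PiE_ext[of _ D "\<lambda>_. UNIV"]) (auto simp: prolong_apply)

text \<open>The data \<open>f'\<close>, \<open>c'\<close> absorb exactly the contributions of the boundary values \<open>w\<close>.\<close>

lemma restricted_QVI_iff:
  "QVI_on D D L f' Z B' c' u \<longleftrightarrow> QVI_on D G L f Z B c (prolong u)"
proof -
  have "impulse_op D Z B' c' u x = impulse_op G Z B c (prolong u) x" for x
  proof -
    have "(\<lambda>\<delta>. app D (B' \<delta>) u x - c' \<delta> x) ` controls D Z =
        (\<lambda>\<delta>. app G (B \<delta>) (prolong u) x - c \<delta> x) ` ext_control G D ` controls D Z"
      unfolding image_image app_boundary_ext[OF finite_G D_subset]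
      by (simp add: restr_B_def restr_c_def algebra_simps)
    then show ?thesis by (simp add: impulse_op_def ext_control_image)
  qed
  then show ?thesis
    by (simp add: QVI_on_def app_boundary_ext[OF finite_G D_subset] restr_f_def prolong_apply
        algebra_simps)
qed

lemma restricted_QVI_unique:
  assumes v: "v \<in> vectors G" "QVI_on D G L f Z B c v" "\<forall>x\<in>G - D. v x = w x"
    and u: "u \<in> vectors D"
  shows "QVI_on D D L f' Z B' c' u \<longleftrightarrow> u = restrict v D"
proof -
  have ext: "prolong (restrict v D) = v"
    by (rule PiE_ext[OF prolong_in v(1)]) (use v(3) in \<open>auto simp: boundary_ext_def\<close>)
  show ?thesis
  proof
    assume "QVI_on D D L f' Z B' c' u"
    then have "QVI_on D G L f Z B c (prolong u)" by (simp add: restricted_QVI_iff)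
    then have "prolong u = v"
      using constrained_QVI_unique v prolong_in prolong_complement by blast
    then show "u = restrict v D" using restrict_prolong[OF u] by simp
  next
    assume "u = restrict v D"
    then show "QVI_on D D L f' Z B' c' u" using v(2) by (simp add: restricted_QVI_iff ext)
  qed
qed


section \<open>Policy matrices\<close>

definition row_option :: "strategy \<Rightarrow> real \<Rightarrow> control option" where
  "row_option = (\<lambda>(I, \<delta>) x. if x \<in> I then Some (ext_control G D \<delta>) else None)"

lemma row_option_in: "\<phi> \<in> \<Phi>' \<Longrightarrow> row_option \<phi> x \<in> options"
  using ext_control_in by (auto simp: row_option_def strategies_def)

lemma pmat_row: "pmat \<phi> x y = option_mat L B (row_option \<phi> x) x y"
  by (cases \<phi>) (simp add: policy_mat_def row_option_def restr_B_def)

lemma app_pmat: "app S (pmat \<phi>) u x = app S (option_mat L B (row_option \<phi> x)) u x"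
  by (simp add: app_def pmat_row)

lemma policy_residual:
  assumes "x \<in> D"
  shows "- app D (pmat \<phi>) u x + pvec \<phi> x = residual (row_option \<phi> x) (prolong u) x"
proof -
  obtain I \<delta> where \<phi>: "\<phi> = (I, \<delta>)" by (cases \<phi>)
  have "app (G - D) (\<lambda>x y. ident x y - M x y) w x = - app (G - D) M w x" for M
    using assms by (auto simp: app_def ident_def sum_negf[symmetric] intro!: sum.cong)
  then show ?thesis
    unfolding app_pmat option_residual_def app_boundary_ext[OF finite_G D_subset]
    by (auto simp: \<phi> row_option_def policy_vec_def restr_f_def restr_c_def app_def sum_negf)
qed

lemma policy_argmax_iff:
  "\<phi> \<in> policy_argmax D \<Phi>' pmat pvec u \<longleftrightarrow> \<phi> \<in> \<Phi>' \<and>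
    (\<forall>\<psi>\<in>\<Phi>'. \<forall>x\<in>D. residual (row_option \<psi> x) (prolong u) x
      \<le> residual (row_option \<phi> x) (prolong u) x)"
  by (simp only: policy_argmax_def mem_Collect_eq policy_residual cong: ball_cong)

lemma policy_solves_iff:
  "solves D (pmat \<phi>) (pvec \<phi>) u \<longleftrightarrow> (\<forall>x\<in>D. residual (row_option \<phi> x) (prolong u) x = 0)"
proof -
  have "app D (pmat \<phi>) u x = pvec \<phi> x \<longleftrightarrow> residual (row_option \<phi> x) (prolong u) x = 0"
    if "x \<in> D" for x
    using policy_residual[OF that, of \<phi> u] by linarith
  then show ?thesis by (simp add: solves_def)
qed

text \<open>
  Monotonicity concerns the matrix alone, so costs cannot exclude the closed set of maximum points.
  The walks of the graph condition do: all points of the set are intervention points, so some walk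
  leaves it.
\<close>

lemma policy_monotone:
  assumes \<phi>: "\<phi> \<in> \<Phi>'" and le: "\<And>x. x \<in> D \<Longrightarrow> app D (pmat \<phi>) u x \<le> app D (pmat \<phi>) v x"
    and z: "z \<in> D"
  shows "u z \<le> v z"
proof (rule ccontr)
  assume not_le: "\<not> u z \<le> v z"
  obtain I \<delta> where I: "\<phi> = (I, \<delta>)" "I \<subseteq> neg_part G" "\<delta> \<in> controls D Z"
    using \<phi> by (auto simp: strategies_def)
  let ?\<delta> = "ext_control G D \<delta>"
  \<comment> \<open>Extension by zero keeps positive maxima in \<open>D\<close> and makes the row sums over all of \<open>G\<close> usable.\<close>
  define d where "d = boundary_ext G D (\<lambda>_. 0) (\<lambda>x. u x - v x)"
  have "0 < d z" "z \<in> G" using not_le z D_subset by (auto simp: d_def boundary_ext_def)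
  from positive_max_set[where d = d, OF finite_G this(2,1)] obtain S
    where S_ne: "S \<noteq> {}" and SG: "S \<subseteq> G" and pos: "\<And>x. x \<in> S \<Longrightarrow> 0 < d x"
    and max: "\<And>A x. x \<in> S \<Longrightarrow> L0_matrix G A \<Longrightarrow> 0 \<le> (\<Sum>y\<in>G. A x y) \<Longrightarrow> app G A d x \<le> 0 \<Longrightarrow>
      (\<Sum>y\<in>G. A x y) = 0 \<and> (\<forall>y\<in>G. A x y \<noteq> 0 \<longrightarrow> y \<in> S)"
    by metis
  have SD: "x \<in> D" if "x \<in> S" for x
    using pos[OF that] SG that by (auto simp: d_def boundary_ext_def split: if_splits)
  have closed: "(\<Sum>y\<in>G. option_mat L B (row_option \<phi> x) x y) = 0 \<and>
      (\<forall>y\<in>G. option_mat L B (row_option \<phi> x) x y \<noteq> 0 \<longrightarrow> y \<in> S)" if x: "x \<in> S" for x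
  proof (rule max[OF x option_L0 option_row_sum_nonneg])
    show "row_option \<phi> x \<in> options" "row_option \<phi> x \<in> options" using row_option_in[OF \<phi>] by auto
    show "x \<in> G" using x SG by blast
    have "app G (option_mat L B (row_option \<phi> x)) d x = app D (pmat \<phi>) (\<lambda>x. u x - v x) x"
      unfolding d_def app_boundary_ext[OF finite_G D_subset] app_pmat by (simp add: app_def)
    then show "app G (option_mat L B (row_option \<phi> x)) d x \<le> 0"
      using le[OF SD[OF x]] by (simp add: app_diff)
  qed
  have SI: "x \<in> I" if x: "x \<in> S" for x
    using closed[OF x] None_row_sum_pos[of x] x SG by (auto simp: I(1) row_option_def split: if_splits)
  obtain x where x: "x \<in> S" using S_ne by blast
  have "(I, ?\<delta>) \<in> strategies G G Z" using I ext_control_in by (auto simp: strategies_def)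
  then obtain y where y: "y \<in> G - I" "(x, y) \<in> (graph G (B ?\<delta>))\<^sup>+"
    using A0 SI[OF x] unfolding A0_def by blast
  have step: "z' \<in> S" if "y' \<in> S" "(y', z') \<in> graph G (B ?\<delta>)" for y' z'
    using that closed[of y'] SI[of y']
    by (cases "y' = z'") (auto simp: graph_def I(1) row_option_def ident_def)
  from y(2) have "y \<in> S"
    by (induction rule: trancl_induct) (auto intro: step x)
  with y(1) SI show False by blast
qed

lemma policy_solvable:
  assumes \<phi>: "\<phi> \<in> \<Phi>'"
  shows "\<exists>!u. u \<in> vectors D \<and> solves D (pmat \<phi>) (pvec \<phi>) u"
proof -
  have "u x = 0" if "\<And>x. x \<in> D \<Longrightarrow> app D (pmat \<phi>) u x = 0" "x \<in> D" for u x
    using policy_monotone[OF \<phi>, of u "\<lambda>_. 0" x] policy_monotone[OF \<phi>, of "\<lambda>_. 0" u x] that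
    by (simp add: app_const)
  then obtain u where u: "\<forall>x\<in>D. app D (pmat \<phi>) u x = pvec \<phi> x"
    using solvable_if_injective[OF finite_D, of "pmat \<phi>" "pvec \<phi>"] by blast
  show ?thesis
  proof (rule ex1I[of _ "restrict u D"])
    show "restrict u D \<in> vectors D \<and> solves D (pmat \<phi>) (pvec \<phi>) (restrict u D)"
      using u by (simp add: solves_def app_def)
    fix u' assume u': "u' \<in> vectors D \<and> solves D (pmat \<phi>) (pvec \<phi>) u'"
    have "u' x = u x" if "x \<in> D" for x
      using u u' that policy_monotone[OF \<phi>, of u' u x] policy_monotone[OF \<phi>, of u u' x]
      by (simp add: solves_def antisym)
    then show "u' = restrict u D"
      using u' by (intro PiE_ext[of _ D "\<lambda>_. UNIV"]) auto
  qed
qed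


section \<open>Policy improvement for the QVI\<close>

text \<open>
  Row \<open>x\<close> of the objective depends on \<open>\<delta>\<close> through \<open>\<delta> x\<close> only, so the rows can be maximized
  separately and the maximizing values assembled into one control.
\<close>

lemma policy_argmax_nonempty: "policy_argmax D \<Phi>' pmat pvec u \<noteq> {}"
proof -
  let ?v = "prolong u"
  define imp where "imp = (\<lambda>\<delta> x. residual (Some (ext_control G D \<delta>)) ?v x)"
  have "finite (Z x) \<and> Z x \<noteq> {}" if "x \<in> D" for x
    using that D_subset by (intro Z_finite) auto
  then have finite_controls_D: "finite (controls D Z)" "controls D Z \<noteq> {}"
    using finite_D by (simp_all add: finite_PiE PiE_eq_empty_iff)
  have "\<exists>\<delta>. \<delta> \<in> controls D Z \<and> (\<forall>\<delta>'\<in>controls D Z. imp \<delta>' x \<le> imp \<delta> x)" for x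
  proof -
    have "Max ((\<lambda>\<delta>. imp \<delta> x) ` controls D Z) \<in> (\<lambda>\<delta>. imp \<delta> x) ` controls D Z"
      using finite_controls_D by (intro Max_in) auto
    then obtain \<delta> where \<delta>: "\<delta> \<in> controls D Z" "imp \<delta> x = Max ((\<lambda>\<delta>. imp \<delta> x) ` controls D Z)"
      by auto
    have "imp \<delta>' x \<le> imp \<delta> x" if "\<delta>' \<in> controls D Z" for \<delta>'
      unfolding \<delta>(2) using finite_controls_D(1) that by simp
    with \<delta>(1) show ?thesis by blast
  qed
  then have "\<forall>x. \<exists>\<delta>. \<delta> \<in> controls D Z \<and> (\<forall>\<delta>'\<in>controls D Z. imp \<delta>' x \<le> imp \<delta> x)" ..
  from choice[OF this] obtain best where best: "\<And>x. best x \<in> controls D Z"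
    "\<And>x \<delta>. \<delta> \<in> controls D Z \<Longrightarrow> imp \<delta> x \<le> imp (best x) x" by blast
  define \<delta>o where "\<delta>o = (\<lambda>x\<in>D. best x x)"
  have \<delta>o: "\<delta>o \<in> controls D Z" using best(1) by (auto simp: \<delta>o_def PiE_iff)
  have imp_cong: "imp \<delta>1 x = imp \<delta>2 x"
    if "\<delta>1 \<in> controls D Z" "\<delta>2 \<in> controls D Z" "x \<in> D" "\<delta>1 x = \<delta>2 x" for \<delta>1 \<delta>2 x
  proof -
    have x: "x \<in> G" using that D_subset by blast
    have "ext_control G D \<delta>1 x = ext_control G D \<delta>2 x"
      using that(3,4) by (simp add: ext_control_apply)
    then have eq: "(\<forall>y\<in>G. B (ext_control G D \<delta>1) x y = B (ext_control G D \<delta>2) x y) \<and>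
        c (ext_control G D \<delta>1) x = c (ext_control G D \<delta>2) x"
      using decoupled ext_control_in[OF that(1)] ext_control_in[OF that(2)] x
      unfolding row_decoupled_def by blast
    then have "app G (B (ext_control G D \<delta>1)) ?v x = app G (B (ext_control G D \<delta>2)) ?v x"
      unfolding app_def by (intro sum.cong) auto
    with eq show ?thesis by (simp add: imp_def option_residual_Some[OF finite_G x])
  qed
  have \<delta>o_best: "imp \<delta> x \<le> imp \<delta>o x" if "\<delta> \<in> controls D Z" "x \<in> D" for \<delta> x
    using best(2)[OF that(1), of x] imp_cong[OF \<delta>o best(1) that(2)] that(2) by (simp add: \<delta>o_def)
  define Io where "Io = {x \<in> neg_part G. residual None ?v x \<le> imp \<delta>o x}"
  have "(Io, \<delta>o) \<in> \<Phi>'" using \<delta>o by (auto simp: strategies_def Io_def)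
  moreover have "residual (row_option \<psi> x) ?v x \<le> residual (row_option (Io, \<delta>o) x) ?v x"
    if \<psi>: "\<psi> \<in> \<Phi>'" and x: "x \<in> D" for \<psi> x
  proof -
    obtain I \<delta> where I: "\<psi> = (I, \<delta>)" "I \<subseteq> neg_part G" "\<delta> \<in> controls D Z"
      using \<psi> by (auto simp: strategies_def)
    show ?thesis
      using \<delta>o_best[OF I(3) x] I(2) by (auto simp: I(1) row_option_def Io_def imp_def)
  qed
  ultimately have "(Io, \<delta>o) \<in> policy_argmax D \<Phi>' pmat pvec u"
    unfolding policy_argmax_iff by blast
  then show ?thesis by blast
qed

text \<open>
  Every option at \<open>x < 0\<close> is a row of some strategy.  At \<open>x \<ge> 0\<close> the intervention rows are missing
  from the strategies, but there the residual of an idle intervention is \<open>- c \<delta> x < 0\<close>, which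
  affects neither the sign conditions nor the attainment of zero.
\<close>

lemma policy_optimal_iff_QVI:
  assumes idle: "idle_on_nonneg G D Z B"
    and \<phi>: "\<phi> \<in> policy_argmax D \<Phi>' pmat pvec u"
  shows "solves D (pmat \<phi>) (pvec \<phi>) u \<longleftrightarrow> QVI_on D D L f' Z B' c' u"
proof -
  let ?v = "prolong u"
  have \<phi>_in: "\<phi> \<in> \<Phi>'" and best: "\<And>\<psi> x. \<psi> \<in> \<Phi>' \<Longrightarrow> x \<in> D \<Longrightarrow>
      residual (row_option \<psi> x) ?v x \<le> residual (row_option \<phi> x) ?v x"
    using \<phi> unfolding policy_argmax_iff by blast+
  have idle_neg: "residual (Some \<delta>) ?v x < 0" if "\<delta> \<in> controls G Z" "x \<in> D" "0 \<le> x" for \<delta> x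
  proof -
    have x: "x \<in> G" using that D_subset by blast
    have "app G (\<lambda>x y. ident x y - B \<delta> x y) ?v x = 0"
      unfolding app_def using idle that by (intro sum.neutral) (auto simp: idle_on_nonneg_def)
    then show ?thesis using c_pos[OF that(1) x] by (simp add: option_residual_def)
  qed
  have dominated: "residual k ?v x \<le> residual (row_option \<phi> x) ?v x"
    if "k \<in> options" "x \<in> D" "x < 0 \<or> k = None" for k x
  proof -
    obtain \<delta>0 where "\<delta>0 \<in> controls G Z" using controls_nonempty by blast
    then have None: "({}, restrict \<delta>0 D) \<in> \<Phi>'"
      using ext_control_restrict(1) by (simp add: strategies_def)
    show ?thesis
    proof (cases k)
      case k: None
      show ?thesis using best[OF None that(2)] by (simp add: k row_option_def)
    next
      case (Some \<delta>)
      then have \<delta>: "\<delta> \<in> controls G Z" "x < 0" using that by auto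
      then have "({x}, restrict \<delta> D) \<in> \<Phi>'"
        using ext_control_restrict(1) that(2) D_subset by (auto simp: strategies_def)
      from best[OF this that(2)] show ?thesis
        by (simp add: Some row_option_def ext_control_restrict(2)[OF \<delta>(1)])
    qed
  qed
  have "residual (row_option \<phi> x) ?v x = 0 \<longleftrightarrow>
      (\<forall>k\<in>options. residual k ?v x \<le> 0) \<and> (\<exists>k\<in>options. residual k ?v x = 0)"
    (is "_ \<longleftrightarrow> ?le \<and> ?eq") if x: "x \<in> D" for x
  proof
    assume zero: "residual (row_option \<phi> x) ?v x = 0"
    have ?le
    proof
      fix k assume k: "k \<in> options"
      show "residual k ?v x \<le> 0"
      proof (cases "x < 0 \<or> k = None")
        case True
        from dominated[OF k x this] show ?thesis unfolding zero .
      next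
        case False
        then obtain \<delta> where "k = Some \<delta>" "\<delta> \<in> controls G Z" "0 \<le> x" using k by auto
        then show ?thesis using idle_neg[of \<delta> x] x by simp
      qed
    qed
    moreover have ?eq using zero row_option_in[OF \<phi>_in] by blast
    ultimately show "?le \<and> ?eq" ..
  next
    assume QVI: "?le \<and> ?eq"
    then obtain k where k: "k \<in> options" "residual k ?v x = 0" by blast
    have "x < 0 \<or> k = None"
    proof (rule ccontr)
      assume "\<not> ?thesis"
      then obtain \<delta> where "k = Some \<delta>" "\<delta> \<in> controls G Z" "0 \<le> x" using k(1) by auto
      then show False using idle_neg[of \<delta> x] x k(2) by simp
    qed
    from dominated[OF k(1) x this] have "0 \<le> residual (row_option \<phi> x) ?v x"
      unfolding k(2) .
    moreover have "residual (row_option \<phi> x) ?v x \<le> 0"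
      using QVI row_option_in[OF \<phi>_in] by blast
    ultimately show "residual (row_option \<phi> x) ?v x = 0" by simp
  qed
  then show ?thesis
    unfolding policy_solves_iff restricted_QVI_iff QVI_iff_residual by (rule ball_cong[OF refl])
qed

lemma policy_iteration_converges:
  assumes idle: "idle_on_nonneg G D Z B"
    and v: "v \<in> vectors G" "QVI_on D G L f Z B c v" "\<forall>x\<in>G - D. v x = w x"
    and pol: "policy_iteration D \<Phi>' pmat pvec u"
  shows "\<exists>K\<le>card \<Phi>'. \<forall>k\<ge>K. u k = restrict v D"
proof (rule policy_iteration_terminates[OF finite_strategies _ _ pol])
  show "u x \<le> v x" if "\<phi> \<in> \<Phi>'" "\<And>x. x \<in> D \<Longrightarrow> app D (pmat \<phi>) u x \<le> app D (pmat \<phi>) v x" "x \<in> D"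
    for \<phi> u v x
    using that by (rule policy_monotone)
  show "solves D (pmat \<phi>) (pvec \<phi>) u \<longleftrightarrow> u = restrict v D"
    if "u \<in> vectors D" "\<phi> \<in> policy_argmax D \<Phi>' pmat pvec u" for u \<phi>
    using policy_optimal_iff_QVI[OF idle that(2)] restricted_QVI_unique[OF v that(1)] by simp
qed

end

lemma symmetric_grid_finite: "symmetric_grid G \<Longrightarrow> finite G"
  by (auto simp: symmetric_grid_def)

theorem theorem2p2p3:
  fixes G :: "real set" and L :: "real mat" and f :: "real vec"
    and Z :: "real \<Rightarrow> real set" and B :: "control \<Rightarrow> real mat" and c :: "control \<Rightarrow> real vec"
    and D :: "real set" and w :: "real vec"
  assumes grid: "symmetric_grid G"
    and Z_finite: "\<And>x. x \<in> G \<Longrightarrow> finite (Z x) \<and> Z x \<noteq> {}"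
    and Z_nonneg: "\<And>x. x \<in> G \<Longrightarrow> x \<ge> 0 \<Longrightarrow> Z x = {0}"
    and c_pos: "\<And>\<delta> x. \<delta> \<in> controls G Z \<Longrightarrow> x \<in> G \<Longrightarrow> c \<delta> x > 0"
    and decoupled: "row_decoupled G Z B c"
    and A0: "A0 G Z B"
    and A1: "A1 G L Z B"
    and D: "nonpos_part G \<subseteq> D" "D \<subseteq> G"
  shows
    "let
       constrained = (\<lambda>v. QVI_on D G L f Z B c v \<and> (\<forall>x\<in>G - D. v x = w x));
       f' = restr_f G D L f w; B' = restr_B G D B; c' = restr_c G D B c w;
       \<Phi>' = strategies G D Z; A = policy_mat L B'; b = policy_vec f' c'
     in
       (\<exists>!v. v \<in> vectors G \<and> constrained v) \<and>
       (\<forall>v\<in>vectors G. constrained v \<longrightarrow>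
          (\<forall>u\<in>vectors D. QVI_on D D L f' Z B' c' u \<longleftrightarrow> u = restrict v D) \<and>
          (\<forall>u\<in>vectors D. policy_argmax D \<Phi>' A b u \<noteq> {} \<and>
             (\<forall>\<phi>\<in>policy_argmax D \<Phi>' A b u. \<exists>!u'. u' \<in> vectors D \<and> solves D (A \<phi>) (b \<phi>) u')) \<and>
          (idle_on_nonneg G D Z B \<longrightarrow>
             (\<forall>u. policy_iteration D \<Phi>' A b u \<longrightarrow>
                (\<exists>K\<le>card \<Phi>'. \<forall>k\<ge>K. u k = restrict v D))))"
proof -
  interpret impulse_qvi G L f Z B c D w
  proof
    show "finite G" using grid by (rule symmetric_grid_finite)
    show "neg_part G \<subseteq> D" using D(1) by auto
    show "Z x = {0}" if "x \<in> G - D" for x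
    proof (rule Z_nonneg)
      show "0 \<le> x" using that D(1) by (cases "x \<le> 0") auto
    qed (use that in blast)
  qed (fact Z_finite c_pos decoupled A0 A1 D(2))+
  have argmax: "\<phi> \<in> \<Phi>'" if "\<phi> \<in> policy_argmax D \<Phi>' pmat pvec u" for \<phi> u
    using that by (simp add: policy_argmax_def)
  show ?thesis
    unfolding Let_def
  proof (intro conjI ballI impI allI; (elim conjE)?)
    show "\<exists>!v. v \<in> vectors G \<and> QVI_on D G L f Z B c v \<and> (\<forall>x\<in>G - D. v x = w x)"
      by (rule constrained_QVI_unique)
    fix v assume v: "v \<in> vectors G" "QVI_on D G L f Z B c v" "\<forall>x\<in>G - D. v x = w x"
    show "QVI_on D D L f' Z B' c' u \<longleftrightarrow> u = restrict v D" if "u \<in> vectors D" for u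
      using v that by (rule restricted_QVI_unique)
    show "policy_argmax D \<Phi>' pmat pvec u \<noteq> {}" for u
      by (rule policy_argmax_nonempty)
    show "\<exists>!u'. u' \<in> vectors D \<and> solves D (pmat \<phi>) (pvec \<phi>) u'"
      if "\<phi> \<in> policy_argmax D \<Phi>' pmat pvec u" for \<phi> u
      using argmax[OF that] by (rule policy_solvable)
    show "\<exists>K\<le>card \<Phi>'. \<forall>k\<ge>K. u k = restrict v D"
      if "idle_on_nonneg G D Z B" "policy_iteration D \<Phi>' pmat pvec u" for u
      using that(1) v that(2) by (rule policy_iteration_converges)
  qed
qed

end
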